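(* Let $G$ be a Lie group with finitely many connected components, and let $(g,\nabla)$ and $(g',\nabla')$ be left-invariant statistical structures on $G$. Then $(g,\nabla)\approx(g',\nabla')$ in $\mathcal{L}\mathrm{Stat}(G)$ if and only if there exists a scaling statistical isomorphism compatible with the group structure between $(G,g,\nabla)$ and $(G,g',\nabla')$.
   Context: A statistical structure on a manifold $M$ is a pair $(g,\nabla)$ of a Riemannian metric $g$ and a torsion-free affine connection $\nabla$ such that $(X,Y,Z)\mapsto(\nabla_X g)(Y,Z)$ is totally symmetric. A statistical structure on a Lie group $G$ is left-invariant if both $g$ and $\nabla$ are invariant under left translations; $\mathcal{L}\mathrm{Stat}(G)$ is the set of these. $\mathbb{R}_{>0}\times\mathrm{Aut}(G)$ acts on $\mathcal{L}\mathrm{Stat}(G)$ by $(r,\varphi).(g,\nabla)=(r\,(\varphi^{-1})^*g,(\varphi^{-1})^*\nabla)$, and $(g,\nabla)\approx(g',\nabla')$ means that they lie in the same orbit. A scaling statistical isomorphism from $(M,g,\nabla)$ to $(M',g',\nabla')$ is a pair $(f,r)$ of a diffeomorphism $f:M\to M'$ and a real number $r>0$ with $f^*\nabla'=\nabla$ and $f^*g'=r\cdot g$. When $M=M'=G$, it is compatible with the group structure if there exists $\varphi\in\mathrm{Aut}(G)$ such that $f(hx)=\varphi(h)f(x)$ for all $h,x\in G$. *)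

theory Defs
  imports "HOL-Analysis.Analysis" "HOL-Algebra.Group_Action"
begin

section \<open>Smooth maps between open subsets of model spaces\<close>

text \<open>
  Derivatives are taken in the ambient space, so these notions are meaningful for open \<open>S\<close>,
  which is the only case in which they are used.
\<close>

primrec Ck_on :: "nat \<Rightarrow> 'e::real_normed_vector set \<Rightarrow> ('e \<Rightarrow> 'f::real_normed_vector) \<Rightarrow> bool"
  where
    "Ck_on 0 S f \<longleftrightarrow> continuous_on S f"
  | "Ck_on (Suc k) S f \<longleftrightarrow>
       (\<forall>x\<in>S. f differentiable (at x)) \<and>
       (\<forall>v. Ck_on k S (\<lambda>x. frechet_derivative f (at x) v))"

definition smooth_on :: "'e::real_normed_vector set \<Rightarrow> ('e \<Rightarrow> 'f::real_normed_vector) \<Rightarrow> bool"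
  where "smooth_on S f \<longleftrightarrow> (\<forall>k. Ck_on k S f)"


section \<open>Smooth manifolds\<close>

text \<open>
  The model space is a finite-dimensional real inner product space, that is, a copy of
  \<open>\<real>\<^sup>n\<close>. The class \<open>euclidean_space\<close> is not used because it excludes \<open>n = 0\<close>.
\<close>

definition finite_dimensional :: "'e::real_inner itself \<Rightarrow> bool"
  where "finite_dimensional _ \<longleftrightarrow> (\<exists>B::'e set. finite B \<and> span B = UNIV)"

record ('a, 'e) manifold =
  mtop :: "'a topology"
  charts :: "('a set \<times> ('a \<Rightarrow> 'e)) set"

abbreviation mset :: "('a, 'e) manifold \<Rightarrow> 'a set"
  where "mset M \<equiv> topspace (mtop M)"

text \<open>The atlas need not be maximal.\<close>

definition smooth_manifold :: "('a, 'e::real_inner) manifold \<Rightarrow> bool"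
  where "smooth_manifold M \<longleftrightarrow>
    finite_dimensional TYPE('e) \<and>
    Hausdorff_space (mtop M) \<and>
    second_countable (mtop M) \<and>
    (\<forall>(U, \<phi>) \<in> charts M.
       openin (mtop M) U \<and> open (\<phi> ` U) \<and>
       homeomorphic_map (subtopology (mtop M) U) (top_of_set (\<phi> ` U)) \<phi>) \<and>
    (\<Union>(U, \<phi>) \<in> charts M. U) = mset M \<and>
    (\<forall>(U, \<phi>) \<in> charts M. \<forall>(V, \<psi>) \<in> charts M.
       smooth_on (\<phi> ` (U \<inter> V)) (\<psi> \<circ> inv_into U \<phi>))"

definition prod_manifold ::
    "('a, 'e) manifold \<Rightarrow> ('b, 'f) manifold \<Rightarrow> ('a \<times> 'b, 'e \<times> 'f) manifold"
  where "prod_manifold M N =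
    \<lparr>mtop = prod_topology (mtop M) (mtop N),
     charts = {(U \<times> V, map_prod \<phi> \<psi>) | U \<phi> V \<psi>. (U, \<phi>) \<in> charts M \<and> (V, \<psi>) \<in> charts N}\<rparr>"

definition smooth_map ::
    "('a, 'e::real_inner) manifold \<Rightarrow> ('b, 'f::real_inner) manifold \<Rightarrow> ('a \<Rightarrow> 'b) \<Rightarrow> bool"
  where "smooth_map M N f \<longleftrightarrow>
    continuous_map (mtop M) (mtop N) f \<and>
    (\<forall>(U, \<phi>) \<in> charts M. \<forall>(V, \<psi>) \<in> charts N.
       smooth_on (\<phi> ` (U \<inter> f -` V)) (\<psi> \<circ> f \<circ> inv_into U \<phi>))"

definition diffeomorphism ::
    "('a, 'e::real_inner) manifold \<Rightarrow> ('b, 'f::real_inner) manifold \<Rightarrow> ('a \<Rightarrow> 'b) \<Rightarrow> bool"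
  where "diffeomorphism M N f \<longleftrightarrow>
    bij_betw f (mset M) (mset N) \<and> smooth_map M N f \<and> smooth_map N M (inv_into (mset M) f)"


section \<open>Tangent vectors and vector fields\<close>

text \<open>
  Tangent vectors at \<open>p\<close> are the derivations at \<open>p\<close> of the algebra \<open>C_infty M\<close> of smooth
  real-valued functions. So that every object is determined by its values on its proper domain,
  and equality of functions is equality of the geometric objects, all functions (smooth functions,
  tangent vectors, vector fields, metrics, connections) are extended by zero outside that domain.
\<close>

type_synonym 'a tvec = "('a \<Rightarrow> real) \<Rightarrow> real"
type_synonym 'a vfield = "'a \<Rightarrow> 'a tvec"
type_synonym 'a metric = "'a \<Rightarrow> 'a tvec \<Rightarrow> 'a tvec \<Rightarrow> real"
type_synonym 'a connection = "'a vfield \<Rightarrow> 'a vfield \<Rightarrow> 'a vfield"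

definition C_infty :: "('a, 'e::real_inner) manifold \<Rightarrow> ('a \<Rightarrow> real) set"
  where "C_infty M =
    {u. (\<forall>(U, \<phi>) \<in> charts M. smooth_on (\<phi> ` U) (u \<circ> inv_into U \<phi>)) \<and>
        (\<forall>x. x \<notin> mset M \<longrightarrow> u x = 0)}"

definition tangent_space :: "('a, 'e::real_inner) manifold \<Rightarrow> 'a \<Rightarrow> 'a tvec set"
  where "tangent_space M p =
    {v. (\<forall>u\<in>C_infty M. \<forall>w\<in>C_infty M. v (\<lambda>x. u x + w x) = v u + v w) \<and>
        (\<forall>c. \<forall>u\<in>C_infty M. v (\<lambda>x. c * u x) = c * v u) \<and>
        (\<forall>u\<in>C_infty M. \<forall>w\<in>C_infty M. v (\<lambda>x. u x * w x) = u p * v w + w p * v u) \<and>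
        (\<forall>u. u \<notin> C_infty M \<longrightarrow> v u = 0)}"

definition tv_add :: "'a tvec \<Rightarrow> 'a tvec \<Rightarrow> 'a tvec"
  where "tv_add v w = (\<lambda>u. v u + w u)"

definition tv_scale :: "real \<Rightarrow> 'a tvec \<Rightarrow> 'a tvec"
  where "tv_scale c v = (\<lambda>u. c * v u)"

definition tv_zero :: "'a tvec"
  where "tv_zero = (\<lambda>u. 0)"

definition vf_apply :: "'a vfield \<Rightarrow> ('a \<Rightarrow> real) \<Rightarrow> 'a \<Rightarrow> real"
  where "vf_apply X u = (\<lambda>p. X p u)"

definition vector_fields :: "('a, 'e::real_inner) manifold \<Rightarrow> 'a vfield set"
  where "vector_fields M =
    {X. (\<forall>p\<in>mset M. X p \<in> tangent_space M p) \<and>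
        (\<forall>p. p \<notin> mset M \<longrightarrow> X p = tv_zero) \<and>
        (\<forall>u\<in>C_infty M. vf_apply X u \<in> C_infty M)}"

definition vf_add :: "'a vfield \<Rightarrow> 'a vfield \<Rightarrow> 'a vfield"
  where "vf_add X Y = (\<lambda>p. tv_add (X p) (Y p))"

definition vf_scale :: "('a \<Rightarrow> real) \<Rightarrow> 'a vfield \<Rightarrow> 'a vfield"
  where "vf_scale u X = (\<lambda>p. tv_scale (u p) (X p))"

definition vf_zero :: "'a vfield"
  where "vf_zero = (\<lambda>p. tv_zero)"

definition lie_bracket :: "'a vfield \<Rightarrow> 'a vfield \<Rightarrow> 'a vfield"
  where "lie_bracket X Y = (\<lambda>p u. X p (vf_apply Y u) - Y p (vf_apply X u))"


section \<open>Metrics, connections and statistical structures\<close>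

definition riemannian_metric :: "('a, 'e::real_inner) manifold \<Rightarrow> 'a metric \<Rightarrow> bool"
  where "riemannian_metric M g \<longleftrightarrow>
    (\<forall>p\<in>mset M.
       (\<forall>v\<in>tangent_space M p. \<forall>w\<in>tangent_space M p. g p v w = g p w v) \<and>
       (\<forall>v\<in>tangent_space M p. \<forall>v'\<in>tangent_space M p. \<forall>w\<in>tangent_space M p.
          g p (tv_add v v') w = g p v w + g p v' w) \<and>
       (\<forall>c. \<forall>v\<in>tangent_space M p. \<forall>w\<in>tangent_space M p.
          g p (tv_scale c v) w = c * g p v w) \<and>
       (\<forall>v\<in>tangent_space M p. v \<noteq> tv_zero \<longrightarrow> g p v v > 0)) \<and>
    (\<forall>X\<in>vector_fields M. \<forall>Y\<in>vector_fields M. (\<lambda>p. g p (X p) (Y p)) \<in> C_infty M) \<and>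
    (\<forall>p v w. \<not> (p \<in> mset M \<and> v \<in> tangent_space M p \<and> w \<in> tangent_space M p)
       \<longrightarrow> g p v w = 0)"

definition affine_connection :: "('a, 'e::real_inner) manifold \<Rightarrow> 'a connection \<Rightarrow> bool"
  where "affine_connection M D \<longleftrightarrow>
    (\<forall>X\<in>vector_fields M. \<forall>Y\<in>vector_fields M. D X Y \<in> vector_fields M) \<and>
    (\<forall>X\<in>vector_fields M. \<forall>X'\<in>vector_fields M. \<forall>Y\<in>vector_fields M.
       D (vf_add X X') Y = vf_add (D X Y) (D X' Y)) \<and>
    (\<forall>u\<in>C_infty M. \<forall>X\<in>vector_fields M. \<forall>Y\<in>vector_fields M.
       D (vf_scale u X) Y = vf_scale u (D X Y)) \<and>
    (\<forall>X\<in>vector_fields M. \<forall>Y\<in>vector_fields M. \<forall>Y'\<in>vector_fields M.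
       D X (vf_add Y Y') = vf_add (D X Y) (D X Y')) \<and>
    (\<forall>c. \<forall>X\<in>vector_fields M. \<forall>Y\<in>vector_fields M.
       D X (vf_scale (\<lambda>_. c) Y) = vf_scale (\<lambda>_. c) (D X Y)) \<and>
    (\<forall>u\<in>C_infty M. \<forall>X\<in>vector_fields M. \<forall>Y\<in>vector_fields M.
       D X (vf_scale u Y) = vf_add (vf_scale (vf_apply X u) Y) (vf_scale u (D X Y))) \<and>
    (\<forall>X Y. \<not> (X \<in> vector_fields M \<and> Y \<in> vector_fields M) \<longrightarrow> D X Y = vf_zero)"

definition torsion_free :: "('a, 'e::real_inner) manifold \<Rightarrow> 'a connection \<Rightarrow> bool"
  where "torsion_free M D \<longleftrightarrow>
    (\<forall>X\<in>vector_fields M. \<forall>Y\<in>vector_fields M.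
       vf_add (D X Y) (vf_scale (\<lambda>_. - 1) (D Y X)) = lie_bracket X Y)"

definition metric_derivative ::
    "'a connection \<Rightarrow> 'a metric \<Rightarrow> 'a vfield \<Rightarrow> 'a vfield \<Rightarrow> 'a vfield \<Rightarrow> 'a \<Rightarrow> real"
  where "metric_derivative D g X Y Z =
    (\<lambda>p. vf_apply X (\<lambda>q. g q (Y q) (Z q)) p - g p (D X Y p) (Z p) - g p (Y p) (D X Z p))"

text \<open>Total symmetry is expressed by invariance under two transpositions generating \<open>S\<^sub>3\<close>.\<close>

definition statistical_structure ::
    "('a, 'e::real_inner) manifold \<Rightarrow> 'a metric \<Rightarrow> 'a connection \<Rightarrow> bool"
  where "statistical_structure M g D \<longleftrightarrow>
    riemannian_metric M g \<and> affine_connection M D \<and> torsion_free M D \<and>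
    (\<forall>X\<in>vector_fields M. \<forall>Y\<in>vector_fields M. \<forall>Z\<in>vector_fields M.
       metric_derivative D g X Y Z = metric_derivative D g Y X Z \<and>
       metric_derivative D g X Y Z = metric_derivative D g X Z Y)"


section \<open>Pullbacks\<close>

definition pullback_fun ::
    "('a, 'e::real_inner) manifold \<Rightarrow> ('a \<Rightarrow> 'b) \<Rightarrow> ('b \<Rightarrow> real) \<Rightarrow> 'a \<Rightarrow> real"
  where "pullback_fun M f u = (\<lambda>x. if x \<in> mset M then u (f x) else 0)"

definition tangent_map ::
    "('a, 'e::real_inner) manifold \<Rightarrow> ('b, 'f::real_inner) manifold \<Rightarrow> ('a \<Rightarrow> 'b) \<Rightarrow>
     'a tvec \<Rightarrow> 'b tvec"
  where "tangent_map M N f v = (\<lambda>u. if u \<in> C_infty N then v (pullback_fun M f u) else 0)"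

text \<open>The following operations along \<open>f\<close> are used for diffeomorphisms only.\<close>

definition pushforward_field ::
    "('a, 'e::real_inner) manifold \<Rightarrow> ('b, 'f::real_inner) manifold \<Rightarrow> ('a \<Rightarrow> 'b) \<Rightarrow>
     'a vfield \<Rightarrow> 'b vfield"
  where "pushforward_field M N f X =
    (\<lambda>q. if q \<in> mset N then tangent_map M N f (X (inv_into (mset M) f q)) else tv_zero)"

definition pullback_metric ::
    "('a, 'e::real_inner) manifold \<Rightarrow> ('b, 'f::real_inner) manifold \<Rightarrow> ('a \<Rightarrow> 'b) \<Rightarrow>
     'b metric \<Rightarrow> 'a metric"
  where "pullback_metric M N f g =
    (\<lambda>p v w. if p \<in> mset M \<and> v \<in> tangent_space M p \<and> w \<in> tangent_space M p
       then g (f p) (tangent_map M N f v) (tangent_map M N f w) else 0)"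

definition pullback_connection ::
    "('a, 'e::real_inner) manifold \<Rightarrow> ('b, 'f::real_inner) manifold \<Rightarrow> ('a \<Rightarrow> 'b) \<Rightarrow>
     'b connection \<Rightarrow> 'a connection"
  where "pullback_connection M N f D =
    (\<lambda>X Y. if X \<in> vector_fields M \<and> Y \<in> vector_fields M
       then pushforward_field N M (inv_into (mset M) f)
              (D (pushforward_field M N f X) (pushforward_field M N f Y))
       else vf_zero)"

definition metric_scale :: "real \<Rightarrow> 'a metric \<Rightarrow> 'a metric"
  where "metric_scale r g = (\<lambda>p v w. r * g p v w)"

definition scaling_statistical_isomorphism ::
    "('a, 'e::real_inner) manifold \<Rightarrow> 'a metric \<Rightarrow> 'a connection \<Rightarrow>
     ('b, 'f::real_inner) manifold \<Rightarrow> 'b metric \<Rightarrow> 'b connection \<Rightarrow>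
     ('a \<Rightarrow> 'b) \<Rightarrow> real \<Rightarrow> bool"
  where "scaling_statistical_isomorphism M g D N g' D' f r \<longleftrightarrow>
    diffeomorphism M N f \<and> r > 0 \<and>
    pullback_connection M N f D' = D \<and>
    pullback_metric M N f g' = metric_scale r g"


section \<open>Lie groups and left-invariant statistical structures\<close>

definition lie_group :: "('a, 'c) monoid_scheme \<Rightarrow> ('a, 'e::real_inner) manifold \<Rightarrow> bool"
  where "lie_group G M \<longleftrightarrow>
    group G \<and> smooth_manifold M \<and> mset M = carrier G \<and>
    smooth_map (prod_manifold M M) M (\<lambda>(x, y). x \<otimes>\<^bsub>G\<^esub> y) \<and>
    smooth_map M M (\<lambda>x. inv\<^bsub>G\<^esub> x)"

definition left_invariant ::
    "('a, 'c) monoid_scheme \<Rightarrow> ('a, 'e::real_inner) manifold \<Rightarrow>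
     'a metric \<Rightarrow> 'a connection \<Rightarrow> bool"
  where "left_invariant G M g D \<longleftrightarrow>
    (\<forall>a\<in>carrier G.
       pullback_metric M M (\<lambda>x. a \<otimes>\<^bsub>G\<^esub> x) g = g \<and>
       pullback_connection M M (\<lambda>x. a \<otimes>\<^bsub>G\<^esub> x) D = D)"

definition LStat ::
    "('a, 'c) monoid_scheme \<Rightarrow> ('a, 'e::real_inner) manifold \<Rightarrow> ('a metric \<times> 'a connection) set"
  where "LStat G M = {(g, D). statistical_structure M g D \<and> left_invariant G M g D}"

definition lie_auto ::
    "('a, 'c) monoid_scheme \<Rightarrow> ('a, 'e::real_inner) manifold \<Rightarrow> ('a \<Rightarrow> 'a) set"
  where "lie_auto G M = {\<phi> \<in> auto G. diffeomorphism M M \<phi>}"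

definition positive_reals :: "real monoid"
  where "positive_reals = \<lparr>carrier = {0<..}, mult = (*), one = 1\<rparr>"

definition scaling_auto_group ::
    "('a, 'c) monoid_scheme \<Rightarrow> ('a, 'e::real_inner) manifold \<Rightarrow> (real \<times> ('a \<Rightarrow> 'a)) monoid"
  where "scaling_auto_group G M =
    positive_reals \<times>\<times> AutoGroup G \<lparr>carrier := lie_auto G M\<rparr>"

definition stat_action ::
    "('a, 'e::real_inner) manifold \<Rightarrow> real \<times> ('a \<Rightarrow> 'a) \<Rightarrow>
     'a metric \<times> 'a connection \<Rightarrow> 'a metric \<times> 'a connection"
  where "stat_action M = (\<lambda>(r, \<phi>) (g, D).
    (metric_scale r (pullback_metric M M (inv_into (mset M) \<phi>) g),
     pullback_connection M M (inv_into (mset M) \<phi>) D))"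

definition stat_equiv ::
    "('a, 'c) monoid_scheme \<Rightarrow> ('a, 'e::real_inner) manifold \<Rightarrow>
     'a metric \<times> 'a connection \<Rightarrow> 'a metric \<times> 'a connection \<Rightarrow> bool"
  where "stat_equiv G M s t \<longleftrightarrow> t \<in> orbit (scaling_auto_group G M) (stat_action M) s"

definition group_compatible ::
    "('a, 'c) monoid_scheme \<Rightarrow> ('a, 'e::real_inner) manifold \<Rightarrow> ('a \<Rightarrow> 'a) \<Rightarrow> bool"
  where "group_compatible G M f \<longleftrightarrow>
    (\<exists>\<phi>\<in>lie_auto G M. \<forall>h\<in>carrier G. \<forall>x\<in>carrier G. f (h \<otimes>\<^bsub>G\<^esub> x) = \<phi> h \<otimes>\<^bsub>G\<^esub> f x)"

end

theory Submission
  imports Defs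
begin

text \<open>
  Pulling a metric or a connection back along a diffeomorphism is contravariantly functorial
  (\<open>pullback_metric_compose\<close>, \<open>pullback_connection_compose\<close>). Hence, for an automorphism \<open>\<phi>\<close>,
  saying that \<open>(r, \<phi>)\<close> carries \<open>(g, D)\<close> to \<open>(g', D')\<close> is the same as saying that
  \<open>\<phi>\<^sup>* g' = r g\<close> and \<open>\<phi>\<^sup>* D' = D\<close>. An automorphism is compatible with the group structure,
  accompanied by itself, so equivalent structures are related by a compatible scaling statistical
  isomorphism.

  Conversely, let \<open>f\<close> be such an isomorphism with accompanying automorphism \<open>\<phi>\<close>, and put \<open>a = f \<one>\<close>. Evaluating
  \<open>f (h \<otimes> x) = \<phi> h \<otimes> f x\<close> at \<open>x = \<one>\<close> gives \<open>f h = \<phi> h \<otimes> a\<close>. Therefore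
  \<open>\<psi> x = a\<^sup>-\<^sup>1 \<otimes> f x = a\<^sup>-\<^sup>1 \<otimes> \<phi> x \<otimes> a\<close>
  is an automorphism; it differs from \<open>\<phi>\<close> by an inner automorphism and from \<open>f\<close> by a left
  translation (\<open>translated_compatible_diffeomorphism_is_lie_auto\<close>). The structure \<open>(g', D')\<close> does not
  see left translations, so \<open>\<psi>\<close> pulls it back to the same structure as \<open>f\<close> does, and \<open>(r, \<psi>)\<close>
  carries \<open>(g, D)\<close> to \<open>(g', D')\<close>.

  The analytic input is that smooth maps compose and pull smooth functions back to smooth
  functions. Both are instances of \<open>smooth_on_chart_composite\<close>, which rests on the chain rule
  \<open>Ck_on_compose\<close> in finite dimensions and on the local nature of smoothness.
\<close>

section \<open>Calculus of \<open>C\<^sup>k\<close> maps\<close>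

lemma Ck_on_subset: "Ck_on k S f \<Longrightarrow> T \<subseteq> S \<Longrightarrow> Ck_on k T f"
proof (induction k arbitrary: f)
  case 0
  then show ?case using continuous_on_subset by auto
next
  case (Suc k)
  then show ?case by auto
qed

lemma Ck_on_local:
  assumes "\<And>x. x \<in> S \<Longrightarrow> \<exists>T. open T \<and> x \<in> T \<and> Ck_on k T f"
  shows "Ck_on k S f"
  using assms
proof (induction k arbitrary: f)
  case 0
  have "isCont f x" if "x \<in> S" for x
    using 0[OF that] by (auto simp: continuous_on_eq_continuous_at)
  then show ?case by (simp add: continuous_at_imp_continuous_on)
next
  case (Suc k)
  have "f differentiable (at x)" if "x \<in> S" for x
    using Suc.prems[OF that] by auto
  moreover have "Ck_on k S (\<lambda>x. frechet_derivative f (at x) v)" for v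
    using Suc.prems by (intro Suc.IH) (metis Ck_on.simps(2))
  ultimately show ?case by simp
qed

lemma Ck_on_has_derivative:
  "Ck_on (Suc k) S f \<Longrightarrow> x \<in> S \<Longrightarrow> (f has_derivative frechet_derivative f (at x)) (at x)"
  by (simp add: frechet_derivative_works)

text \<open>
  Openness is essential: a Frechet derivative at a point of \<open>S\<close> depends on values around that point,
  so agreement on \<open>S\<close> controls it only when \<open>S\<close> is a neighbourhood.
\<close>

lemma Ck_on_cong:
  assumes "open S" and "\<And>x. x \<in> S \<Longrightarrow> f x = h x" and "Ck_on k S f"
  shows "Ck_on k S h"
  using assms(2,3)
proof (induction k arbitrary: f h)
  case 0
  then show ?case by (metis Ck_on.simps(1) continuous_on_cong)
next
  case (Suc k)
  have d: "(h has_derivative frechet_derivative f (at x)) (at x)" if "x \<in> S" for x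
    using Ck_on_has_derivative[OF Suc.prems(2) that] assms(1) that Suc.prems(1)
    by (rule has_derivative_transform_within_open)
  have "Ck_on k S (\<lambda>x. frechet_derivative h (at x) v)" for v
    by (rule Suc.IH[where f = "\<lambda>x. frechet_derivative f (at x) v"])
       (use Suc.prems frechet_derivative_at[OF d] in auto)
  then show ?case using d by (auto simp: differentiable_def)
qed

text \<open>
  Higher differentiability can be checked on any explicit formula for the derivative, which spares
  all later inductions from handling \<^const>\<open>frechet_derivative\<close> of a compound expression.
\<close>

lemma Ck_on_SucI:
  assumes "open S" and "\<And>x. x \<in> S \<Longrightarrow> (f has_derivative f' x) (at x)"
    and "\<And>v. Ck_on k S (\<lambda>x. f' x v)"
  shows "Ck_on (Suc k) S f"
proof -
  have "Ck_on k S (\<lambda>x. frechet_derivative f (at x) v)" for v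
    using assms(1) _ assms(3)[of v]
    by (rule Ck_on_cong) (use frechet_derivative_at[OF assms(2)] in auto)
  then show ?thesis using assms(2) by (auto simp: differentiable_def)
qed

lemma Ck_on_Suc_imp: "Ck_on (Suc k) S f \<Longrightarrow> Ck_on k S f"
proof (induction k arbitrary: f)
  case 0
  then show ?case
    by (auto intro!: continuous_at_imp_continuous_on differentiable_imp_continuous_within)
next
  case (Suc k)
  then show ?case by (metis Ck_on.simps(2))
qed

lemma Ck_on_const: "Ck_on k S (\<lambda>x. c)"
  by (induction k arbitrary: c) auto

lemma Ck_on_bounded_linear:
  assumes "open S" and "bounded_linear L" and "Ck_on k S f"
  shows "Ck_on k S (\<lambda>x. L (f x))"
  using assms(3)
proof (induction k arbitrary: f)
  case 0
  then show ?case using bounded_linear.continuous_on[OF assms(2)] by auto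
next
  case (Suc k)
  show ?case
    by (rule Ck_on_SucI[OF assms(1) bounded_linear.has_derivative[OF assms(2)]],
        erule Ck_on_has_derivative[OF Suc.prems]) (use Suc in simp)
qed

lemma Ck_on_add:
  assumes "open S" and "Ck_on k S f" and "Ck_on k S h"
  shows "Ck_on k S (\<lambda>x. f x + h x)"
  using assms(2,3)
proof (induction k arbitrary: f h)
  case 0
  then show ?case by (auto intro: continuous_on_add)
next
  case (Suc k)
  show ?case
    by (rule Ck_on_SucI[OF assms(1) has_derivative_add],
        erule Ck_on_has_derivative[OF Suc.prems(1)], erule Ck_on_has_derivative[OF Suc.prems(2)])
       (use Suc in simp)
qed

lemma Ck_on_sum:
  assumes "open S" and "\<And>i. i \<in> I \<Longrightarrow> Ck_on k S (f i)"
  shows "Ck_on k S (\<lambda>x. \<Sum>i\<in>I. f i x)"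
  using assms(2)
  by (induction I rule: infinite_finite_induct)
     (auto simp: Ck_on_const intro: Ck_on_add[OF assms(1)])

lemma Ck_on_scaleR:
  assumes "open S" and "Ck_on k S a" and "Ck_on k S f"
  shows "Ck_on k S (\<lambda>x. a x *\<^sub>R f x)"
  using assms(2,3)
proof (induction k arbitrary: a f)
  case 0
  then show ?case by (auto intro: continuous_on_scaleR)
next
  case (Suc k)
  have "Ck_on k S a" "Ck_on k S f"
    using Suc.prems Ck_on_Suc_imp by blast+
  then show ?case
    by (intro Ck_on_SucI[OF assms(1) has_derivative_scaleR[OF
            Ck_on_has_derivative[OF Suc.prems(1)] Ck_on_has_derivative[OF Suc.prems(2)]]]
        Ck_on_add[OF assms(1)] Suc.IH) (use Suc.prems in simp_all)
qed

text \<open>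
  Coordinates with respect to an orthogonal spanning set. They are given by inner products and are
  therefore bounded linear, hence smooth. If \<open>0 \<in> C\<close>, its term vanishes because division by
  zero yields zero.
\<close>

lemma orthogonal_expansion:
  fixes C :: "'e::real_inner set"
  assumes "finite C" and "span C = UNIV" and "pairwise orthogonal C"
  shows "v = (\<Sum>c\<in>C. (inner v c / inner c c) *\<^sub>R c)"
proof -
  let ?P = "\<lambda>v. \<Sum>c\<in>C. (inner v c / inner c c) *\<^sub>R c"
  have "linear ?P"
    by (intro linearI)
       (simp_all add: inner_add_left add_divide_distrib scaleR_left_distrib sum.distrib
          scaleR_sum_right)
  moreover have "id b = ?P b" if b: "b \<in> C" for b
  proof -
    have "?P b = (\<Sum>c\<in>C. if c = b then b else 0)"
      using assms(3) b by (intro sum.cong) (auto simp: pairwise_def orthogonal_def)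
    then show ?thesis using b assms(1) by simp
  qed
  ultimately have "id v = ?P v"
    using assms(2) linear_eq_on_span[of id ?P C v] linear_id by auto
  then show ?thesis by simp
qed

text \<open>
  The derivative of the composite in direction \<open>v\<close> is \<open>x \<mapsto> Dh (f x) (Df x v)\<close>, where both the base
  point and the direction of \<open>Dh\<close> move, whereas \<^const>\<open>Ck_on\<close> controls \<open>Dh\<close> in fixed directions
  only. Expanding \<open>Df x v\<close> in a finite orthogonal set \<open>C\<close> turns it into a finite sum of products of
  coordinates of \<open>Df x v\<close> with the maps \<open>x \<mapsto> Dh (f x) c\<close> for fixed \<open>c \<in> C\<close>; the induction
  hypothesis applies to these. This is where the finite dimension of the intermediate space enters.
\<close>

lemma Ck_on_compose:
  fixes h :: "'e::real_inner \<Rightarrow> 'g::real_normed_vector"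
  assumes fd: "finite_dimensional TYPE('e)" and "open S" and "open T" and "f ` S \<subseteq> T"
    and "Ck_on k S f" and "Ck_on k T h"
  shows "Ck_on k S (\<lambda>x. h (f x))"
proof -
  obtain B :: "'e set" where B: "finite B" "span B = UNIV"
    using fd by (auto simp: finite_dimensional_def)
  obtain C :: "'e set" where C: "finite C" "span C = UNIV" "pairwise orthogonal C"
    using basis_orthogonal[OF B(1)] B(2) by auto
  show ?thesis
    using assms(5,6)
  proof (induction k arbitrary: h)
    case 0
    then show ?case using assms(4) by (auto intro: continuous_on_compose2)
  next
    case (Suc k)
    let ?Df = "\<lambda>x. frechet_derivative f (at x)" and ?Dh = "\<lambda>y. frechet_derivative h (at y)"
    have Dh: "(h has_derivative ?Dh y) (at y)" if "y \<in> T" for y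
      using Ck_on_has_derivative[OF Suc.prems(2) that] .
    have expand: "?Dh y w = (\<Sum>c\<in>C. (inner w c / inner c c) *\<^sub>R ?Dh y c)" if "y \<in> T" for y w
    proof -
      have "linear (?Dh y)" using Dh[OF that] has_derivative_linear by blast
      then show ?thesis
        by (subst orthogonal_expansion[OF C, of w]) (simp add: linear_sum linear_scale)
    qed
    show ?case
    proof (rule Ck_on_SucI[OF assms(2)])
      fix x assume x: "x \<in> S"
      show "((\<lambda>x. h (f x)) has_derivative (\<lambda>v. ?Dh (f x) (?Df x v))) (at x)"
        using has_derivative_compose[OF Ck_on_has_derivative[OF Suc.prems(1) x] Dh] x assms(4)
        by auto
    next
      fix v
      have "Ck_on k S (\<lambda>x. \<Sum>c\<in>C. (inner (?Df x v) c / inner c c) *\<^sub>R ?Dh (f x) c)"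
      proof (intro Ck_on_sum Ck_on_scaleR assms(2))
        fix c :: 'e
        have "bounded_linear (\<lambda>w. inner w c / inner c c)"
          by (intro bounded_linear_divide bounded_linear_compose[OF bounded_linear_divide]
              bounded_linear_inner_left)
        then show "Ck_on k S (\<lambda>x. inner (?Df x v) c / inner c c)"
          by (rule Ck_on_bounded_linear[OF assms(2)]) (use Suc.prems(1) in simp)
        show "Ck_on k S (\<lambda>x. ?Dh (f x) c)"
          using Suc.prems Ck_on_Suc_imp by (intro Suc.IH) auto
      qed
      then show "Ck_on k S (\<lambda>x. ?Dh (f x) (?Df x v))"
        by (rule Ck_on_cong[OF assms(2), rotated]) (use expand assms(4) in auto)
    qed
  qed
qed

text \<open>
  The derivative of \<open>F\<close> along the slice in direction \<open>v\<close>
  is its derivative in the constant direction \<open>(0, v)\<close>, so the induction closes by itself.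
\<close>

lemma Ck_on_slice:
  assumes "open S" and "\<And>y. y \<in> S \<Longrightarrow> (c, y) \<in> T" and "Ck_on k T F"
  shows "Ck_on k S (\<lambda>y. F (c, y))"
  using assms(3)
proof (induction k arbitrary: F)
  case 0
  then show ?case
    using assms(2) by (auto intro!: continuous_on_compose2[of T F] continuous_intros)
next
  case (Suc k)
  show ?case
  proof (rule Ck_on_SucI[OF assms(1)])
    fix y assume y: "y \<in> S"
    have "((\<lambda>y. (c, y)) has_derivative (\<lambda>v. (0, v))) (at y)"
      by (auto intro!: derivative_eq_intros)
    then show "((\<lambda>y. F (c, y)) has_derivative
        (\<lambda>v. frechet_derivative F (at (c, y)) (0, v))) (at y)"
      by (rule has_derivative_compose) (use Ck_on_has_derivative[OF Suc.prems assms(2)[OF y]] in simp)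
  next
    show "Ck_on k S (\<lambda>y. frechet_derivative F (at (c, y)) (0, v))" for v
      using Suc.prems by (intro Suc.IH) simp
  qed
qed

lemma smooth_on_cong:
  "open S \<Longrightarrow> (\<And>x. x \<in> S \<Longrightarrow> f x = h x) \<Longrightarrow> smooth_on S f \<Longrightarrow> smooth_on S h"
  unfolding smooth_on_def using Ck_on_cong by blast

lemma smooth_on_local:
  assumes "\<And>x. x \<in> S \<Longrightarrow> \<exists>T. open T \<and> x \<in> T \<and> smooth_on T f"
  shows "smooth_on S f"
  unfolding smooth_on_def by (metis Ck_on_local assms smooth_on_def)

lemma smooth_on_subset: "smooth_on S f \<Longrightarrow> T \<subseteq> S \<Longrightarrow> smooth_on T f"
  unfolding smooth_on_def using Ck_on_subset by blast

lemma smooth_on_compose: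
  fixes h :: "'e::real_inner \<Rightarrow> 'g::real_normed_vector"
  assumes "finite_dimensional TYPE('e)" and "open S" and "open T" and "f ` S \<subseteq> T"
    and "smooth_on S f" and "smooth_on T h"
  shows "smooth_on S (\<lambda>x. h (f x))"
  using assms Ck_on_compose[of S T f _ h] unfolding smooth_on_def by blast

lemma smooth_on_slice:
  "open S \<Longrightarrow> (\<And>y. y \<in> S \<Longrightarrow> (c, y) \<in> T) \<Longrightarrow> smooth_on T F \<Longrightarrow> smooth_on S (\<lambda>y. F (c, y))"
  unfolding smooth_on_def using Ck_on_slice by blast


section \<open>Smooth maps and diffeomorphisms between manifolds\<close>

lemma
  assumes "smooth_manifold M" and "(U, \<phi>) \<in> charts M"
  shows chart_openin: "openin (mtop M) U"
    and chart_subset: "U \<subseteq> mset M"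
    and chart_inj_on: "inj_on \<phi> U"
    and chart_open_image: "openin (mtop M) W \<Longrightarrow> open (\<phi> ` (U \<inter> W))"
proof -
  have c: "openin (mtop M) U" "open (\<phi> ` U)"
    "homeomorphic_map (subtopology (mtop M) U) (top_of_set (\<phi> ` U)) \<phi>"
    using assms unfolding smooth_manifold_def by auto
  show "openin (mtop M) U" by fact
  then show sub: "U \<subseteq> mset M" by (rule openin_subset)
  show "inj_on \<phi> U"
    using homeomorphic_imp_injective_map[OF c(3)] sub by (simp add: Int_absorb1)
  show "open (\<phi> ` (U \<inter> W))" if "openin (mtop M) W"
  proof -
    have "openin (subtopology (mtop M) U) (U \<inter> W)"
      using that by (simp add: openin_subtopology_Int2)
    then have "openin (top_of_set (\<phi> ` U)) (\<phi> ` (U \<inter> W))"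
      using homeomorphic_imp_open_map[OF c(3)] by (auto simp: open_map_def)
    then show ?thesis using c(2) openin_open_trans by blast
  qed
qed

lemma chart_at:
  assumes "smooth_manifold M" and "p \<in> mset M"
  obtains U \<phi> where "(U, \<phi>) \<in> charts M" and "p \<in> U"
proof -
  have "(\<Union>(U, \<phi>) \<in> charts M. U) = mset M"
    using assms(1) unfolding smooth_manifold_def by auto
  then show ?thesis using assms(2) that by auto
qed

lemma smooth_map_image: "smooth_map M N f \<Longrightarrow> x \<in> mset M \<Longrightarrow> f x \<in> mset N"
  unfolding smooth_map_def continuous_map_def by auto

lemma chart_open_preimage:
  assumes "smooth_manifold M" and "(U, \<phi>) \<in> charts M"
    and "continuous_map (mtop M) X f" and "openin X W"
  shows "open (\<phi> ` (U \<inter> f -` W))"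
proof -
  have "openin (mtop M) {x \<in> mset M. f x \<in> W}"
    using assms(3,4) openin_continuous_map_preimage by blast
  moreover have "U \<inter> f -` W = U \<inter> {x \<in> mset M. f x \<in> W}"
    using chart_subset[OF assms(1,2)] by auto
  ultimately show ?thesis using chart_open_image[OF assms(1,2)] by metis
qed

text \<open>
  Near a point, insert a chart \<open>\<psi>\<close> of the intermediate manifold:
  \<open>h \<circ> f \<circ> \<phi>\<^sup>-\<^sup>1 = (h \<circ> \<psi>\<^sup>-\<^sup>1) \<circ> (\<psi> \<circ> f \<circ> \<phi>\<^sup>-\<^sup>1)\<close>. Taking for \<open>h\<close> a map followed by a chart gives the
  composition of smooth maps, and taking a real function gives the pullback of smooth functions; the
  open set \<open>W\<close> on which \<open>h\<close> is smooth differs in the two cases.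
\<close>

lemma smooth_on_chart_composite:
  fixes M :: "('a, 'e::real_inner) manifold" and N :: "('b, 'f::real_inner) manifold"
  assumes M: "smooth_manifold M" and N: "smooth_manifold N" and f: "smooth_map M N f"
    and U: "(U, \<phi>) \<in> charts M" and W: "openin (mtop N) W"
    and h: "\<And>V \<psi>. (V, \<psi>) \<in> charts N \<Longrightarrow> smooth_on (\<psi> ` (V \<inter> W)) (h \<circ> inv_into V \<psi>)"
  shows "smooth_on (\<phi> ` (U \<inter> f -` W)) (h \<circ> f \<circ> inv_into U \<phi>)"
proof (rule smooth_on_local)
  fix y assume "y \<in> \<phi> ` (U \<inter> f -` W)"
  then obtain x where x: "x \<in> U" "f x \<in> W" "y = \<phi> x" by auto
  then have "f x \<in> mset N" using W openin_subset by blast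
  then obtain V \<psi> where V: "(V, \<psi>) \<in> charts N" "f x \<in> V" using chart_at[OF N] by blast
  let ?T = "\<phi> ` (U \<inter> f -` (V \<inter> W))"
  have cf: "continuous_map (mtop M) (mtop N) f" using f by (simp add: smooth_map_def)
  have oT: "open ?T"
    by (intro chart_open_preimage[OF M U cf] openin_Int W chart_openin[OF N V(1)])
  have fd: "finite_dimensional TYPE('f)" using N by (simp add: smooth_manifold_def)
  have "smooth_on (\<phi> ` (U \<inter> f -` V)) (\<psi> \<circ> f \<circ> inv_into U \<phi>)"
    using f U V(1) unfolding smooth_map_def by blast
  then have "smooth_on ?T (\<psi> \<circ> f \<circ> inv_into U \<phi>)"
    by (rule smooth_on_subset) auto
  moreover have "(\<psi> \<circ> f \<circ> inv_into U \<phi>) ` ?T \<subseteq> \<psi> ` (V \<inter> W)"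
    using chart_inj_on[OF M U] by auto
  ultimately have "smooth_on ?T (\<lambda>z. (h \<circ> inv_into V \<psi>) ((\<psi> \<circ> f \<circ> inv_into U \<phi>) z))"
    using smooth_on_compose[OF fd oT chart_open_image[OF N V(1) W]] h[OF V(1)] by blast
  then have "smooth_on ?T (h \<circ> f \<circ> inv_into U \<phi>)"
    by (rule smooth_on_cong[OF oT, rotated])
       (use chart_inj_on[OF M U] chart_inj_on[OF N V(1)] in auto)
  then show "\<exists>T. open T \<and> y \<in> T \<and> smooth_on T (h \<circ> f \<circ> inv_into U \<phi>)"
    using oT x V(2) by blast
qed

lemma smooth_map_compose:
  assumes M: "smooth_manifold M" and N: "smooth_manifold N" and P: "smooth_manifold P"
    and f: "smooth_map M N f" and h: "smooth_map N P h"
  shows "smooth_map M P (h \<circ> f)"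
proof -
  have c: "continuous_map (mtop M) (mtop N) f" "continuous_map (mtop N) (mtop P) h"
    using f h by (auto simp: smooth_map_def)
  have "smooth_on (\<phi> ` (U \<inter> (h \<circ> f) -` W)) (\<omega> \<circ> (h \<circ> f) \<circ> inv_into U \<phi>)"
    if U: "(U, \<phi>) \<in> charts M" and W: "(W, \<omega>) \<in> charts P" for U \<phi> W \<omega>
  proof -
    let ?W = "{y \<in> mset N. h y \<in> W}"
    have "smooth_on (\<psi> ` (V \<inter> ?W)) (\<omega> \<circ> h \<circ> inv_into V \<psi>)" if V: "(V, \<psi>) \<in> charts N" for V \<psi>
    proof -
      have "smooth_on (\<psi> ` (V \<inter> h -` W)) (\<omega> \<circ> h \<circ> inv_into V \<psi>)"
        using h V W unfolding smooth_map_def by blast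
      then show ?thesis by (rule smooth_on_subset) auto
    qed
    moreover have "openin (mtop N) ?W"
      using c(2) chart_openin[OF P W] openin_continuous_map_preimage by blast
    ultimately have "smooth_on (\<phi> ` (U \<inter> f -` ?W)) (\<omega> \<circ> h \<circ> f \<circ> inv_into U \<phi>)"
      using smooth_on_chart_composite[OF M N f U] by blast
    moreover have "U \<inter> f -` ?W = U \<inter> (h \<circ> f) -` W"
      using chart_subset[OF M U] smooth_map_image[OF f] by auto
    ultimately show ?thesis by (simp add: comp_assoc)
  qed
  then show ?thesis
    unfolding smooth_map_def using continuous_map_compose[OF c] by auto
qed

text \<open>
  Maps between manifolds are total functions on the underlying type, so geometric statements must be
  insensitive to values off the manifold. This matters because elements of \<^const>\<open>lie_auto\<close> are
  \<^const>\<open>undefined\<close> there, whereas composites of translations are not. The same remark motivates the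
  other congruence rules below.
\<close>

lemma smooth_map_cong:
  assumes M: "smooth_manifold M" and N: "smooth_manifold N"
    and f: "smooth_map M N f" and eq: "\<And>x. x \<in> mset M \<Longrightarrow> f x = f' x"
  shows "smooth_map M N f'"
proof -
  have c: "continuous_map (mtop M) (mtop N) f" using f by (simp add: smooth_map_def)
  have "smooth_on (\<phi> ` (U \<inter> f' -` V)) (\<psi> \<circ> f' \<circ> inv_into U \<phi>)"
    if U: "(U, \<phi>) \<in> charts M" and V: "(V, \<psi>) \<in> charts N" for U \<phi> V \<psi>
  proof -
    have "U \<inter> f' -` V = U \<inter> f -` V"
      using chart_subset[OF M U] eq by auto
    moreover have "smooth_on (\<phi> ` (U \<inter> f -` V)) (\<psi> \<circ> f \<circ> inv_into U \<phi>)"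
      using f U V unfolding smooth_map_def by blast
    ultimately show ?thesis
      using smooth_on_cong[OF chart_open_preimage[OF M U c chart_openin[OF N V]]]
        chart_subset[OF M U] eq chart_inj_on[OF M U]
      by (smt (verit) IntE comp_apply imageE inv_into_f_f subsetD)
  qed
  then show ?thesis
    unfolding smooth_map_def using continuous_map_eq[OF c] eq by auto
qed

lemma inv_into_cong_on: "(\<And>x. x \<in> A \<Longrightarrow> f x = f' x) \<Longrightarrow> inv_into A f = inv_into A f'"
  unfolding inv_into_def by (intro ext arg_cong[where f = Eps]) auto

lemma diffeomorphism_cong:
  assumes "smooth_manifold M" and "smooth_manifold N"
    and "diffeomorphism M N f" and "\<And>x. x \<in> mset M \<Longrightarrow> f x = f' x"
  shows "diffeomorphism M N f'"
proof -
  have "inv_into (mset M) f' = inv_into (mset M) f"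
    using inv_into_cong_on[of "mset M" f f'] assms(4) by simp
  moreover have "bij_betw f' (mset M) (mset N)"
    using assms(3,4) bij_betw_cong unfolding diffeomorphism_def by blast
  ultimately show ?thesis
    using assms smooth_map_cong[of M N f f'] unfolding diffeomorphism_def by simp
qed

lemma diffeomorphism_inv:
  assumes "smooth_manifold M" and "smooth_manifold N" and "diffeomorphism M N f"
  shows "diffeomorphism N M (inv_into (mset M) f)"
  using assms smooth_map_cong[OF assms(1,2), of f] bij_betw_inv_into inv_into_inv_into_eq
  unfolding diffeomorphism_def by (metis (no_types, lifting))

lemma
  assumes "diffeomorphism M N f"
  shows diffeomorphism_smooth: "smooth_map M N f"
    and diffeomorphism_inv_smooth: "smooth_map N M (inv_into (mset M) f)"
    and diffeomorphism_image: "x \<in> mset M \<Longrightarrow> f x \<in> mset N"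
    and diffeomorphism_inv_image: "y \<in> mset N \<Longrightarrow> inv_into (mset M) f y \<in> mset M"
    and diffeomorphism_inv_left: "x \<in> mset M \<Longrightarrow> inv_into (mset M) f (f x) = x"
    and diffeomorphism_inv_right: "y \<in> mset N \<Longrightarrow> f (inv_into (mset M) f y) = y"
  using assms unfolding diffeomorphism_def
  by (auto simp: smooth_map_image bij_betw_inv_into_left bij_betw_inv_into_right
      dest: bij_betwE bij_betw_inv_into)

lemma diffeomorphism_inv_compose:
  assumes "diffeomorphism M N f" and "diffeomorphism N P h" and "z \<in> mset P"
  shows "inv_into (mset M) (h \<circ> f) z = inv_into (mset M) f (inv_into (mset N) h z)"
proof (rule inv_into_f_eq)
  show "inj_on (h \<circ> f) (mset M)"
    using assms(1,2) bij_betw_trans bij_betw_imp_inj_on unfolding diffeomorphism_def by blast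
qed (use assms in \<open>simp_all add: diffeomorphism_inv_image diffeomorphism_inv_right\<close>)

lemma diffeomorphism_compose:
  assumes M: "smooth_manifold M" and N: "smooth_manifold N" and P: "smooth_manifold P"
    and f: "diffeomorphism M N f" and h: "diffeomorphism N P h"
  shows "diffeomorphism M P (h \<circ> f)"
  unfolding diffeomorphism_def
proof (intro conjI)
  show "bij_betw (h \<circ> f) (mset M) (mset P)"
    using f h bij_betw_trans unfolding diffeomorphism_def by blast
  show "smooth_map M P (h \<circ> f)"
    using f h smooth_map_compose[OF M N P] by (simp add: diffeomorphism_smooth)
  show "smooth_map P M (inv_into (mset M) (h \<circ> f))"
    by (rule smooth_map_cong[OF P M smooth_map_compose[OF P N M
            diffeomorphism_inv_smooth[OF h] diffeomorphism_inv_smooth[OF f]]])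
       (simp add: diffeomorphism_inv_compose[OF f h])
qed


section \<open>Functoriality of tangent maps and pullbacks\<close>

lemma C_infty_add:
  assumes M: "smooth_manifold M" and "u \<in> C_infty M" and "w \<in> C_infty M"
  shows "(\<lambda>x. u x + w x) \<in> C_infty M"
proof -
  have "smooth_on (\<phi> ` U) ((\<lambda>x. u x + w x) \<circ> inv_into U \<phi>)" if "(U, \<phi>) \<in> charts M" for U \<phi>
    using that assms Ck_on_add[of "\<phi> ` U"] chart_open_image[OF M that chart_openin[OF M that]]
    unfolding C_infty_def smooth_on_def comp_def by fastforce
  then show ?thesis using assms(2,3) by (auto simp: C_infty_def)
qed

lemma C_infty_mult:
  assumes M: "smooth_manifold M" and "u \<in> C_infty M" and "w \<in> C_infty M"
  shows "(\<lambda>x. u x * w x) \<in> C_infty M"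
proof -
  have "smooth_on (\<phi> ` U) ((\<lambda>x. u x * w x) \<circ> inv_into U \<phi>)" if "(U, \<phi>) \<in> charts M" for U \<phi>
    using that assms Ck_on_scaleR[of "\<phi> ` U"] chart_open_image[OF M that chart_openin[OF M that]]
    unfolding C_infty_def smooth_on_def comp_def real_scaleR_def by fastforce
  then show ?thesis using assms(2,3) by (auto simp: C_infty_def)
qed

lemma C_infty_scale:
  assumes M: "smooth_manifold M" and "u \<in> C_infty M"
  shows "(\<lambda>x. c * u x) \<in> C_infty M"
proof -
  have "smooth_on (\<phi> ` U) ((\<lambda>x. c * u x) \<circ> inv_into U \<phi>)" if "(U, \<phi>) \<in> charts M" for U \<phi>
    using that assms Ck_on_bounded_linear[OF _ bounded_linear_mult_right, of "\<phi> ` U"]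
      chart_open_image[OF M that chart_openin[OF M that]]
    unfolding C_infty_def smooth_on_def comp_def by fastforce
  then show ?thesis using assms(2) by (auto simp: C_infty_def)
qed

lemma pullback_fun_C_infty:
  assumes M: "smooth_manifold M" and N: "smooth_manifold N" and f: "smooth_map M N f"
    and u: "u \<in> C_infty N"
  shows "pullback_fun M f u \<in> C_infty M"
proof -
  have "smooth_on (\<phi> ` U) (pullback_fun M f u \<circ> inv_into U \<phi>)" if U: "(U, \<phi>) \<in> charts M" for U \<phi>
  proof -
    have "smooth_on (\<psi> ` (V \<inter> mset N)) (u \<circ> inv_into V \<psi>)" if V: "(V, \<psi>) \<in> charts N" for V \<psi>
      using u V chart_subset[OF N V] by (auto simp: C_infty_def Int_absorb2)
    then have "smooth_on (\<phi> ` (U \<inter> f -` mset N)) (u \<circ> f \<circ> inv_into U \<phi>)"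
      using smooth_on_chart_composite[OF M N f U] by blast
    moreover have "U \<inter> f -` mset N = U"
      using chart_subset[OF M U] smooth_map_image[OF f] by auto
    ultimately have "smooth_on (\<phi> ` U) (u \<circ> f \<circ> inv_into U \<phi>)" by simp
    then show ?thesis
      by (rule smooth_on_cong[rotated 2])
         (use chart_open_image[OF M U chart_openin[OF M U]] chart_inj_on[OF M U]
            chart_subset[OF M U] in \<open>auto simp: pullback_fun_def\<close>)
  qed
  then show ?thesis by (auto simp: C_infty_def pullback_fun_def)
qed

lemma pullback_fun_cong:
  "(\<And>x. x \<in> mset M \<Longrightarrow> f x = f' x) \<Longrightarrow> pullback_fun M f = pullback_fun M f'"
  by (auto simp: pullback_fun_def fun_eq_iff)

lemma tangent_map_cong:
  "(\<And>x. x \<in> mset M \<Longrightarrow> f x = f' x) \<Longrightarrow> tangent_map M N f = tangent_map M N f'"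
  unfolding tangent_map_def by (subst pullback_fun_cong[of M f f']) auto

lemma tangent_map_compose:
  assumes "smooth_manifold N" and "smooth_manifold P"
    and "smooth_map M N f" and "smooth_map N P h"
  shows "tangent_map N P h (tangent_map M N f v) = tangent_map M P (h \<circ> f) v"
proof -
  have "pullback_fun M f (pullback_fun N h u) = pullback_fun M (h \<circ> f) u" for u
    using smooth_map_image[OF assms(3)] by (auto simp: pullback_fun_def)
  then show ?thesis
    using pullback_fun_C_infty[OF assms(1,2,4)] by (auto simp: tangent_map_def)
qed

lemma tangent_map_id:
  assumes "v \<in> tangent_space M p" and "\<And>x. x \<in> mset M \<Longrightarrow> f x = x"
  shows "tangent_map M M f v = v"
proof
  fix u
  have "pullback_fun M f u = u" if "u \<in> C_infty M"
    using that assms(2) by (auto simp: pullback_fun_def C_infty_def)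
  then show "tangent_map M M f v u = v u"
    using assms(1) by (auto simp: tangent_map_def tangent_space_def)
qed

lemma tangent_map_in_tangent_space:
  assumes M: "smooth_manifold M" and N: "smooth_manifold N" and f: "smooth_map M N f"
    and p: "p \<in> mset M" and v: "v \<in> tangent_space M p"
  shows "tangent_map M N f v \<in> tangent_space N (f p)"
proof -
  have [simp]: "pullback_fun M f (\<lambda>x. u x + w x) = (\<lambda>x. pullback_fun M f u x + pullback_fun M f w x)"
    "pullback_fun M f (\<lambda>x. u x * w x) = (\<lambda>x. pullback_fun M f u x * pullback_fun M f w x)"
    "pullback_fun M f (\<lambda>x. c * u x) = (\<lambda>x. c * pullback_fun M f u x)"
    "pullback_fun M f (\<lambda>x. c) x * pullback_fun M f u x = c * pullback_fun M f u x"
    "pullback_fun M f u p = u (f p)" for u w c x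
    using p by (auto simp: pullback_fun_def)
  note in_M = pullback_fun_C_infty[OF M N f]
  show ?thesis
    using v unfolding tangent_space_def tangent_map_def
    by (simp add: C_infty_add[OF N] C_infty_mult[OF N] C_infty_scale[OF N] in_M)
qed

lemma pushforward_field_cong:
  assumes "\<And>x. x \<in> mset M \<Longrightarrow> f x = f' x"
  shows "pushforward_field M N f = pushforward_field M N f'"
  unfolding pushforward_field_def
  by (simp only: tangent_map_cong[of M f f', OF assms] inv_into_cong_on[of "mset M" f f', OF assms])

lemma pushforward_field_compose:
  assumes "smooth_manifold N" and "smooth_manifold P"
    and f: "diffeomorphism M N f" and h: "diffeomorphism N P h"
  shows "pushforward_field N P h (pushforward_field M N f X) = pushforward_field M P (h \<circ> f) X"
  using tangent_map_compose[OF assms(1,2) diffeomorphism_smooth[OF f] diffeomorphism_smooth[OF h]]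
    diffeomorphism_inv_image[OF h] diffeomorphism_inv_compose[OF f h]
  by (auto simp: pushforward_field_def)

lemma pushforward_field_id:
  assumes "X \<in> vector_fields M" and "\<And>x. x \<in> mset M \<Longrightarrow> f x = x"
  shows "pushforward_field M M f X = X"
proof
  fix q
  show "pushforward_field M M f X q = X q"
  proof (cases "q \<in> mset M")
    case True
    have "inv_into (mset M) f q = q"
      using True assms(2) by (intro inv_into_f_eq inj_onI) auto
    then show ?thesis
      using True assms(1) tangent_map_id[OF _ assms(2)]
      by (auto simp: pushforward_field_def vector_fields_def)
  next
    case False
    then show ?thesis using assms(1) by (auto simp: pushforward_field_def vector_fields_def)
  qed
qed

text \<open>
  Smoothness comes from \<open>(f\<^sub>* X) u = (X (u \<circ> f)) \<circ> f\<^sup>-\<^sup>1\<close>.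
\<close>

lemma pushforward_field_in_vector_fields:
  assumes M: "smooth_manifold M" and N: "smooth_manifold N" and f: "diffeomorphism M N f"
    and X: "X \<in> vector_fields M"
  shows "pushforward_field M N f X \<in> vector_fields N"
proof -
  have "pushforward_field M N f X q \<in> tangent_space N q" if "q \<in> mset N" for q
    using tangent_map_in_tangent_space[OF M N diffeomorphism_smooth[OF f]
        diffeomorphism_inv_image[OF f that]] X that
    by (simp add: pushforward_field_def vector_fields_def diffeomorphism_inv_image[OF f]
        diffeomorphism_inv_right[OF f])
  moreover have "vf_apply (pushforward_field M N f X) u \<in> C_infty N" if u: "u \<in> C_infty N" for u
  proof -
    have "vf_apply (pushforward_field M N f X) u
        = pullback_fun N (inv_into (mset M) f) (vf_apply X (pullback_fun M f u))"
      using u by (auto simp: fun_eq_iff vf_apply_def pushforward_field_def pullback_fun_def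
          tangent_map_def tv_zero_def)
    also have "\<dots> \<in> C_infty N"
      using X u pullback_fun_C_infty[OF M N diffeomorphism_smooth[OF f]]
        pullback_fun_C_infty[OF N M diffeomorphism_inv_smooth[OF f]]
      by (simp add: vector_fields_def)
    finally show ?thesis .
  qed
  ultimately show ?thesis
    by (simp add: vector_fields_def) (simp add: pushforward_field_def)
qed

lemma pullback_metric_cong:
  assumes "\<And>x. x \<in> mset M \<Longrightarrow> f x = f' x"
  shows "pullback_metric M N f = pullback_metric M N f'"
  using assms by (intro ext) (simp add: pullback_metric_def tangent_map_cong[of M f f'])

lemma pullback_metric_compose:
  assumes M: "smooth_manifold M" and N: "smooth_manifold N" and P: "smooth_manifold P"
    and f: "smooth_map M N f" and h: "smooth_map N P h"
  shows "pullback_metric M N f (pullback_metric N P h g) = pullback_metric M P (h \<circ> f) g"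
  using tangent_map_in_tangent_space[OF M N f] smooth_map_image[OF f]
  by (intro ext) (simp add: pullback_metric_def tangent_map_compose[OF N P f h])

text \<open>
  A Riemannian metric vanishes on arguments that are not tangent vectors at its base point, so it
  is fixed as a total function and not just on the tangent spaces. The analogous rules for vector fields
  and connections work for the same reason.
\<close>

lemma pullback_metric_id:
  assumes "riemannian_metric M g" and "\<And>x. x \<in> mset M \<Longrightarrow> f x = x"
  shows "pullback_metric M M f g = g"
proof (intro ext)
  fix p v w
  show "pullback_metric M M f g p v w = g p v w"
    using assms(1) tangent_map_id[OF _ assms(2)] assms(2)
    unfolding pullback_metric_def riemannian_metric_def by (metis (no_types, lifting))
qed

lemma pullback_metric_scale:
  "pullback_metric M N f (metric_scale r g) = metric_scale r (pullback_metric M N f g)"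
  by (intro ext) (simp add: pullback_metric_def metric_scale_def)

lemma pullback_connection_cong:
  assumes "\<And>x. x \<in> mset M \<Longrightarrow> f x = f' x"
  shows "pullback_connection M N f = pullback_connection M N f'"
  unfolding pullback_connection_def
  by (simp only: pushforward_field_cong[of M f f', OF assms] inv_into_cong_on[of "mset M" f f', OF assms])

lemma pullback_connection_compose:
  assumes M: "smooth_manifold M" and N: "smooth_manifold N" and P: "smooth_manifold P"
    and f: "diffeomorphism M N f" and h: "diffeomorphism N P h"
  shows "pullback_connection M N f (pullback_connection N P h D)
    = pullback_connection M P (h \<circ> f) D"
proof -
  have "pushforward_field P M (inv_into (mset M) f \<circ> inv_into (mset N) h)
      = pushforward_field P M (inv_into (mset M) (h \<circ> f))"
    by (rule pushforward_field_cong) (simp add: diffeomorphism_inv_compose[OF f h])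
  then show ?thesis
    using pushforward_field_in_vector_fields[OF M N f]
    by (auto simp: pullback_connection_def fun_eq_iff pushforward_field_compose[OF N P f h]
        pushforward_field_compose[OF N M diffeomorphism_inv[OF N P h] diffeomorphism_inv[OF M N f]])
qed

lemma pullback_connection_id:
  fixes M :: "('a, 'e::real_inner) manifold"
  assumes D: "affine_connection M D" and f: "\<And>x. x \<in> mset M \<Longrightarrow> f x = x"
  shows "pullback_connection M M f D = D"
proof (rule ext, rule ext)
  fix X Y :: "'a vfield"
  have i: "inv_into (mset M) f x = x" if "x \<in> mset M" for x
    using that f by (intro inv_into_f_eq inj_onI) auto
  show "pullback_connection M M f D X Y = D X Y"
    using D pushforward_field_id[OF _ f] pushforward_field_id[OF _ i]
    unfolding pullback_connection_def affine_connection_def by (metis (no_types, lifting))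
qed


section \<open>Left translations and compatible maps\<close>

text \<open>
  Left translation by \<open>a\<close> is multiplication on the slice \<open>{a} \<times> G\<close>. In a product chart this
  is the slice through \<open>\<psi> a\<close> for a chart \<open>\<psi>\<close> around \<open>a\<close>.
\<close>

lemma lie_group_left_mult_smooth:
  fixes M :: "('a, 'e::real_inner) manifold"
  assumes L: "lie_group G M" and a: "a \<in> carrier G"
  shows "smooth_map M M (\<lambda>x. a \<otimes>\<^bsub>G\<^esub> x)"
proof -
  have M: "smooth_manifold M" and MG: "mset M = carrier G"
    and mu: "smooth_map (prod_manifold M M) M (\<lambda>(x, y). x \<otimes>\<^bsub>G\<^esub> y)"
    using L by (auto simp: lie_group_def)
  have "continuous_map (mtop M) (prod_topology (mtop M) (mtop M)) (\<lambda>x. (a, x))"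
    using a MG by (auto simp: continuous_map_pairwise comp_def)
  then have c: "continuous_map (mtop M) (mtop M) (\<lambda>x. a \<otimes>\<^bsub>G\<^esub> x)"
    using mu continuous_map_compose unfolding smooth_map_def prod_manifold_def comp_def by fastforce
  have "smooth_on (\<phi> ` (U \<inter> (\<lambda>x. a \<otimes>\<^bsub>G\<^esub> x) -` W)) (\<omega> \<circ> (\<lambda>x. a \<otimes>\<^bsub>G\<^esub> x) \<circ> inv_into U \<phi>)"
    if U: "(U, \<phi>) \<in> charts M" and W: "(W, \<omega>) \<in> charts M" for U \<phi> W \<omega>
  proof -
    obtain V \<psi> where V: "(V, \<psi>) \<in> charts M" "a \<in> V"
      using chart_at[OF M] a MG by auto
    let ?S = "\<phi> ` (U \<inter> (\<lambda>x. a \<otimes>\<^bsub>G\<^esub> x) -` W)"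
    let ?T = "map_prod \<psi> \<phi> ` (V \<times> U \<inter> (\<lambda>(x, y). x \<otimes>\<^bsub>G\<^esub> y) -` W)"
    let ?F = "\<omega> \<circ> (\<lambda>(x, y). x \<otimes>\<^bsub>G\<^esub> y) \<circ> inv_into (V \<times> U) (map_prod \<psi> \<phi>)"
    have oS: "open ?S" by (rule chart_open_preimage[OF M U c chart_openin[OF M W]])
    have "(V \<times> U, map_prod \<psi> \<phi>) \<in> charts (prod_manifold M M)"
      using U V(1) by (auto simp: prod_manifold_def)
    then have F: "smooth_on ?T ?F"
      using mu W unfolding smooth_map_def by blast
    have "(\<psi> a, y) \<in> ?T" if "y \<in> ?S" for y
      using that V(2) by force
    then have "smooth_on ?S (\<lambda>y. ?F (\<psi> a, y))"
      by (rule smooth_on_slice[OF oS _ F])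
    moreover have "inv_into (V \<times> U) (map_prod \<psi> \<phi>) (\<psi> a, \<phi> x) = (a, x)" if "x \<in> U" for x
      using that V(2) map_prod_inj_on[OF chart_inj_on[OF M V(1)] chart_inj_on[OF M U]]
      by (intro inv_into_f_eq) auto
    ultimately show ?thesis
      by (elim smooth_on_cong[OF oS, rotated]) (use chart_inj_on[OF M U] in auto)
  qed
  then show ?thesis using c by (auto simp: smooth_map_def)
qed

lemma lie_group_left_mult_diffeomorphism:
  assumes L: "lie_group G M" and a: "a \<in> carrier G"
  shows "diffeomorphism M M (\<lambda>x. a \<otimes>\<^bsub>G\<^esub> x)"
proof -
  interpret group G using L by (simp add: lie_group_def)
  have M: "smooth_manifold M" and MG: "mset M = carrier G"
    using L by (auto simp: lie_group_def)
  have bij: "bij_betw (\<lambda>x. a \<otimes>\<^bsub>G\<^esub> x) (mset M) (mset M)"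
    using a MG by (intro bij_betw_byWitness[where f' = "\<lambda>x. inv\<^bsub>G\<^esub> a \<otimes>\<^bsub>G\<^esub> x"])
      (auto simp: m_assoc[symmetric])
  moreover have "inv\<^bsub>G\<^esub> a \<otimes>\<^bsub>G\<^esub> x = inv_into (mset M) (\<lambda>x. a \<otimes>\<^bsub>G\<^esub> x) x" if "x \<in> mset M" for x
    using that a MG bij_betw_imp_inj_on[OF bij]
    by (intro inv_into_f_eq[symmetric]) (auto simp: m_assoc[symmetric])
  ultimately show ?thesis
    using smooth_map_cong[OF M M lie_group_left_mult_smooth[OF L inv_closed[OF a]]]
      lie_group_left_mult_smooth[OF L a]
    unfolding diffeomorphism_def by blast
qed

text \<open>
  If \<open>\<phi>\<close> is the automorphism accompanying \<open>f\<close>, then \<open>\<phi> x = f x \<otimes> (f \<one>)\<^sup>-\<^sup>1\<close>, so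
  \<open>f (x \<otimes> y) = \<phi> x \<otimes> f y = f x \<otimes> (f \<one>)\<^sup>-\<^sup>1 \<otimes> f y\<close>. Multiplying by \<open>(f \<one>)\<^sup>-\<^sup>1\<close> on the left shows that
  \<open>x \<mapsto> (f \<one>)\<^sup>-\<^sup>1 \<otimes> f x\<close> is multiplicative. The restriction to the carrier makes it extensional,
  as \<^const>\<open>auto\<close> requires.
\<close>

lemma translated_compatible_diffeomorphism_is_lie_auto:
  assumes L: "lie_group G M" and f: "diffeomorphism M M f" and c: "group_compatible G M f"
  shows "(\<lambda>x\<in>carrier G. inv\<^bsub>G\<^esub> (f \<one>\<^bsub>G\<^esub>) \<otimes>\<^bsub>G\<^esub> f x) \<in> lie_auto G M" (is "?\<psi> \<in> _")
proof -
  interpret group G using L by (simp add: lie_group_def)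
  have M: "smooth_manifold M" and MG: "mset M = carrier G"
    using L by (auto simp: lie_group_def)
  have f_in: "f x \<in> carrier G" if "x \<in> carrier G" for x
    using diffeomorphism_image[OF f] that MG by auto
  obtain \<phi> where \<phi>: "\<phi> \<in> lie_auto G M"
    and comp: "\<And>h x. h \<in> carrier G \<Longrightarrow> x \<in> carrier G \<Longrightarrow> f (h \<otimes>\<^bsub>G\<^esub> x) = \<phi> h \<otimes>\<^bsub>G\<^esub> f x"
    using c unfolding group_compatible_def by blast
  have \<phi>_in: "\<phi> x \<in> carrier G" if "x \<in> carrier G" for x
    using \<phi> that by (auto simp: lie_auto_def auto_def hom_def)
  have diffeo: "diffeomorphism M M ?\<psi>"
    by (rule diffeomorphism_cong[OF M M diffeomorphism_compose[OF M M M f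
            lie_group_left_mult_diffeomorphism[OF L inv_closed[OF f_in[OF one_closed]]]]])
       (simp add: MG)
  have "f (x \<otimes>\<^bsub>G\<^esub> y) = f x \<otimes>\<^bsub>G\<^esub> (inv\<^bsub>G\<^esub> (f \<one>\<^bsub>G\<^esub>) \<otimes>\<^bsub>G\<^esub> f y)"
    if "x \<in> carrier G" "y \<in> carrier G" for x y
  proof -
    have "f x = \<phi> x \<otimes>\<^bsub>G\<^esub> f \<one>\<^bsub>G\<^esub>" using comp[OF that(1) one_closed] that(1) by simp
    then have "\<phi> x = f x \<otimes>\<^bsub>G\<^esub> inv\<^bsub>G\<^esub> (f \<one>\<^bsub>G\<^esub>)"
      using that f_in \<phi>_in by (simp add: m_assoc)
    then show ?thesis using comp[OF that] that f_in by (simp add: m_assoc)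
  qed
  then have "?\<psi> \<in> hom G G"
    using f_in by (auto simp: hom_def m_assoc)
  moreover have "?\<psi> \<in> Bij (carrier G)"
    using diffeo MG by (simp add: Bij_def diffeomorphism_def)
  ultimately show ?thesis using diffeo by (simp add: lie_auto_def auto_def)
qed

lemma stat_equiv_iff:
  "stat_equiv G M (g, D) (g', D') \<longleftrightarrow>
    (\<exists>r \<phi>. r > 0 \<and> \<phi> \<in> lie_auto G M \<and>
      g' = metric_scale r (pullback_metric M M (inv_into (mset M) \<phi>) g) \<and>
      D' = pullback_connection M M (inv_into (mset M) \<phi>) D)"
  by (auto simp: stat_equiv_def orbit_def scaling_auto_group_def positive_reals_def stat_action_def)

theorem proposition4p4:
  fixes G :: "('a, 'c) monoid_scheme"
    and M :: "('a, 'e::real_inner) manifold"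
    and g g' :: "'a metric"
    and D D' :: "'a connection"
  assumes "lie_group G M"
    and "finite (connected_components_of (mtop M))"
    and "(g, D) \<in> LStat G M"
    and "(g', D') \<in> LStat G M"
  shows "stat_equiv G M (g, D) (g', D') \<longleftrightarrow>
    (\<exists>f r. scaling_statistical_isomorphism M g D M g' D' f r \<and> group_compatible G M f)"
proof -
  have M: "smooth_manifold M" and MG: "mset M = carrier G"
    using assms(1) by (auto simp: lie_group_def)
  have g: "riemannian_metric M g" and D: "affine_connection M D"
    using assms(3) by (auto simp: LStat_def statistical_structure_def)
  have g': "riemannian_metric M g'" and D': "affine_connection M D'"
    and inv': "left_invariant G M g' D'"
    using assms(4) by (auto simp: LStat_def statistical_structure_def)
  note smooth = diffeomorphism_smooth diffeomorphism_inv_smooth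
  show ?thesis
  proof
    assume "stat_equiv G M (g, D) (g', D')"
    then obtain r \<phi> where r: "r > 0" and \<phi>: "\<phi> \<in> lie_auto G M"
      and eqs: "g' = metric_scale r (pullback_metric M M (inv_into (mset M) \<phi>) g)"
        "D' = pullback_connection M M (inv_into (mset M) \<phi>) D"
      unfolding stat_equiv_iff by blast
    have d: "diffeomorphism M M \<phi>" using \<phi> by (simp add: lie_auto_def)
    note di = diffeomorphism_inv[OF M M d]
    have id: "(inv_into (mset M) \<phi> \<circ> \<phi>) x = x" if "x \<in> mset M" for x
      using diffeomorphism_inv_left[OF d that] by simp
    have "pullback_metric M M \<phi> g' = metric_scale r g"
      unfolding eqs pullback_metric_scale pullback_metric_compose[OF M M M smooth(1)[OF d] smooth(2)[OF d]]
      by (simp only: pullback_metric_id[OF g, of "inv_into (mset M) \<phi> \<circ> \<phi>", OF id])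
    moreover have "pullback_connection M M \<phi> D' = D"
      unfolding eqs pullback_connection_compose[OF M M M d di]
      by (simp only: pullback_connection_id[OF D, of "inv_into (mset M) \<phi> \<circ> \<phi>", OF id])
    moreover have "group_compatible G M \<phi>"
      using \<phi> unfolding group_compatible_def lie_auto_def auto_def hom_def by blast
    ultimately show "\<exists>f r. scaling_statistical_isomorphism M g D M g' D' f r \<and> group_compatible G M f"
      using d r unfolding scaling_statistical_isomorphism_def by blast
  next
    assume "\<exists>f r. scaling_statistical_isomorphism M g D M g' D' f r \<and> group_compatible G M f"
    then obtain f r where f: "diffeomorphism M M f" and r: "r > 0"
      and fD: "pullback_connection M M f D' = D" and fg: "pullback_metric M M f g' = metric_scale r g"
      and c: "group_compatible G M f"
      unfolding scaling_statistical_isomorphism_def by blast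
    interpret group G using assms(1) by (simp add: lie_group_def)
    define b where "b = inv\<^bsub>G\<^esub> (f \<one>\<^bsub>G\<^esub>)"
    define \<psi> where "\<psi> = (\<lambda>x\<in>carrier G. b \<otimes>\<^bsub>G\<^esub> f x)"
    have b: "b \<in> carrier G"
      using diffeomorphism_image[OF f, of "\<one>\<^bsub>G\<^esub>"] MG by (simp add: b_def)
    have \<psi>: "\<psi> \<in> lie_auto G M"
      unfolding \<psi>_def b_def by (rule translated_compatible_diffeomorphism_is_lie_auto[OF assms(1) f c])
    then have d: "diffeomorphism M M \<psi>" by (simp add: lie_auto_def)
    note di = diffeomorphism_inv[OF M M d]
    note Lb = lie_group_left_mult_diffeomorphism[OF assms(1) b]
    have \<psi>_eq: "\<psi> x = ((\<lambda>x. b \<otimes>\<^bsub>G\<^esub> x) \<circ> f) x" if "x \<in> mset M" for x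
      using that MG by (simp add: \<psi>_def)
    have "pullback_metric M M \<psi> g'
        = pullback_metric M M f (pullback_metric M M (\<lambda>x. b \<otimes>\<^bsub>G\<^esub> x) g')"
      unfolding pullback_metric_compose[OF M M M smooth(1)[OF f] smooth(1)[OF Lb]]
      by (rule fun_cong[OF pullback_metric_cong]) (rule \<psi>_eq)
    then have \<psi>g: "pullback_metric M M \<psi> g' = metric_scale r g"
      using inv' b fg by (simp add: left_invariant_def)
    have "pullback_connection M M \<psi> D'
        = pullback_connection M M f (pullback_connection M M (\<lambda>x. b \<otimes>\<^bsub>G\<^esub> x) D')"
      unfolding pullback_connection_compose[OF M M M f Lb]
      by (rule fun_cong[OF pullback_connection_cong]) (rule \<psi>_eq)
    then have \<psi>D: "pullback_connection M M \<psi> D' = D"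
      using inv' b fD by (simp add: left_invariant_def)
    have id: "(\<psi> \<circ> inv_into (mset M) \<psi>) x = x" if "x \<in> mset M" for x
      using diffeomorphism_inv_right[OF d that] by simp
    have "g' = metric_scale r (pullback_metric M M (inv_into (mset M) \<psi>) g)"
      unfolding pullback_metric_scale[symmetric] \<psi>g[symmetric]
        pullback_metric_compose[OF M M M smooth(2)[OF d] smooth(1)[OF d]]
      by (simp only: pullback_metric_id[OF g', of "\<psi> \<circ> inv_into (mset M) \<psi>", OF id])
    moreover have "D' = pullback_connection M M (inv_into (mset M) \<psi>) D"
      unfolding \<psi>D[symmetric] pullback_connection_compose[OF M M M di d]
      by (simp only: pullback_connection_id[OF D', of "\<psi> \<circ> inv_into (mset M) \<psi>", OF id])
    ultimately show "stat_equiv G M (g, D) (g', D')"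
      unfolding stat_equiv_iff using r \<psi> by blast
  qed
qed

end
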